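(* Let $G$ be one-ended, and assume that the support of the edge length distribution $\rho$ contains an interval of the form $[0,h]$ with $h>0$. Then for $\mathbb{P}$-almost every $\omega\in\Omega$, the metric space $(\Gamma,d_\omega)$ is not Gromov-hyperbolic.
   Context: First passage percolation setting. $G$ is a Gromov-hyperbolic group, $\Gamma$ its Cayley graph with respect to a fixed finite symmetric generating set, with vertex set $G$ and edge set $E$. $\rho$ is a probability measure on $[0,\infty)$ with no atoms and with $\int_0^\infty e^{sx}\,d\rho(x)<\infty$ for all $s>0$. $\Omega=[0,\infty)^E$ carries the (completed) product measure $\mathbb{P}=\rho^{\otimes E}$, so the edge lengths $\omega(e)$, $e\in E$, are i.i.d. with law $\rho$. For an edge path $\gamma$, $\ell_\omega(\gamma)=\sum_{e\in\gamma}\omega(e)$, and $d_\omega(x,y)$ is the infimum of $\ell_\omega(\gamma)$ over edge paths $\gamma$ connecting $x$ and $y$. *)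

theory Defs
  imports "HOL-Probability.Probability" "HOL-Algebra.Generated_Groups"
begin

section \<open>Gromov hyperbolicity\<close>

definition gromov_product :: "('a \<Rightarrow> 'a \<Rightarrow> real) \<Rightarrow> 'a \<Rightarrow> 'a \<Rightarrow> 'a \<Rightarrow> real" where
  "gromov_product d w x y = (d x w + d y w - d x y) / 2"

text \<open>Gromov's definition, which does not need the space to be geodesic. It is stated for a set
  and a distance function; that the latter is a (pseudo-)metric is not part of the definition, so
  that the negation cannot hold merely because an axiom of metric spaces fails.\<close>

definition gromov_hyperbolic :: "'a set \<Rightarrow> ('a \<Rightarrow> 'a \<Rightarrow> real) \<Rightarrow> bool" where
  "gromov_hyperbolic X d \<longleftrightarrow>
    (\<exists>\<delta>\<ge>0. \<forall>w\<in>X. \<forall>x\<in>X. \<forall>y\<in>X. \<forall>z\<in>X.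
       gromov_product d w x z \<ge> min (gromov_product d w x y) (gromov_product d w y z) - \<delta>)"

section \<open>Edge paths and the metric induced by edge lengths\<close>

text \<open>A (simple, undirected) graph is given by its set of edges, which are two-element sets of
  vertices. An edge path is represented by the list of the vertices it visits; the one-vertex
  list \<open>[x]\<close> is the trivial path from \<open>x\<close> to \<open>x\<close>.\<close>

fun path_edges :: "'a list \<Rightarrow> 'a set list" where
  "path_edges (x # y # xs) = {x, y} # path_edges (y # xs)"
| "path_edges _ = []"

definition edge_paths :: "'a set set \<Rightarrow> 'a \<Rightarrow> 'a \<Rightarrow> 'a list set" where
  "edge_paths E x y =
     {\<gamma>. \<gamma> \<noteq> [] \<and> hd \<gamma> = x \<and> last \<gamma> = y \<and> set (path_edges \<gamma>) \<subseteq> E}"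

definition path_length :: "('a set \<Rightarrow> real) \<Rightarrow> 'a list \<Rightarrow> real" where
  "path_length \<omega> \<gamma> = (\<Sum>e\<leftarrow>path_edges \<gamma>. \<omega> e)"

definition fpp_dist :: "'a set set \<Rightarrow> ('a set \<Rightarrow> real) \<Rightarrow> 'a \<Rightarrow> 'a \<Rightarrow> real" where
  "fpp_dist E \<omega> x y = (INF \<gamma>\<in>edge_paths E x y. path_length \<omega> \<gamma>)"

text \<open>The graph distance is the case where all edges have length 1.\<close>

abbreviation graph_dist :: "'a set set \<Rightarrow> 'a \<Rightarrow> 'a \<Rightarrow> real" where
  "graph_dist E \<equiv> fpp_dist E (\<lambda>_. 1)"

section \<open>One-ended graphs\<close>

definition components_outside :: "'a set \<Rightarrow> 'a set set \<Rightarrow> 'a set \<Rightarrow> 'a set set" where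
  "components_outside V E K =
     (\<lambda>x. {y. \<exists>\<gamma>\<in>edge_paths E x y. set \<gamma> \<subseteq> V - K}) ` (V - K)"

text \<open>For \<open>K = {}\<close> the condition forces the graph to be infinite.\<close>

definition one_ended :: "'a set \<Rightarrow> 'a set set \<Rightarrow> bool" where
  "one_ended V E \<longleftrightarrow>
     (\<forall>K. finite K \<and> K \<subseteq> V \<longrightarrow> (\<exists>!C. C \<in> components_outside V E K \<and> infinite C))"

section \<open>Cayley graphs\<close>

definition fin_sym_gen_set :: "('a, 'b) monoid_scheme \<Rightarrow> 'a set \<Rightarrow> bool" where
  "fin_sym_gen_set G S \<longleftrightarrow>
     finite S \<and> S \<subseteq> carrier G \<and> (\<forall>s\<in>S. inv\<^bsub>G\<^esub> s \<in> S) \<and> generate G S = carrier G"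

text \<open>Edges are undirected, so \<open>x\<close> and \<open>x s\<close> are joined by a single edge even when \<open>s\<close> is an
  involution. The identity may belong to \<open>S\<close>, but it contributes no loops.\<close>

definition cayley_edges :: "('a, 'b) monoid_scheme \<Rightarrow> 'a set \<Rightarrow> 'a set set" where
  "cayley_edges G S =
     {{x, x \<otimes>\<^bsub>G\<^esub> s} | x s. x \<in> carrier G \<and> s \<in> S \<and> s \<noteq> \<one>\<^bsub>G\<^esub>}"

text \<open>Neither of the following two properties depends on the choice of the generating set.\<close>

definition hyperbolic_group :: "('a, 'b) monoid_scheme \<Rightarrow> bool" where
  "hyperbolic_group G \<longleftrightarrow> group G \<and>
     (\<exists>S. fin_sym_gen_set G S \<and> gromov_hyperbolic (carrier G) (graph_dist (cayley_edges G S)))"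

definition one_ended_group :: "('a, 'b) monoid_scheme \<Rightarrow> bool" where
  "one_ended_group G \<longleftrightarrow> group G \<and>
     (\<exists>S. fin_sym_gen_set G S \<and> one_ended (carrier G) (cayley_edges G S))"

section \<open>Edge length distributions\<close>

definition measure_support :: "'a::topological_space measure \<Rightarrow> 'a set" where
  "measure_support M =
     {x \<in> space M. \<forall>U. open U \<and> x \<in> U \<longrightarrow> emeasure M (U \<inter> space M) > 0}"

text \<open>A probability measure on the space \<open>[0,\<infinity>)\<close> itself, with its Borel sets.\<close>

definition edge_length_distribution :: "real measure \<Rightarrow> bool" where
  "edge_length_distribution \<rho> \<longleftrightarrow>
     prob_space \<rho> \<and> sets \<rho> = sets (restrict_space borel {0..}) \<and>
     (\<forall>x\<ge>0. emeasure \<rho> {x} = 0) \<and>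
     (\<forall>s>0. (\<integral>\<^sup>+ x. ennreal (exp (s * x)) \<partial>\<rho>) < \<infinity>)"

definition fpp_measure :: "'a set set \<Rightarrow> real measure \<Rightarrow> ('a set \<Rightarrow> real) measure" where
  "fpp_measure E \<rho> = completion (\<Pi>\<^sub>M e\<in>E. \<rho>)"

end

theory Submission
  imports Defs
begin

text \<open>Take a geodesic of length \<open>2M\<close> centred at the identity. By one-endedness, its points at
  distance \<open>2r\<close> on either side of the centre are joined by a path \<open>b\<close> outside the ball of radius
  \<open>2r\<close>. If the edges touching that ball have length about \<open>h\<close> and those of \<open>b\<close> have length about 0,
  then a fat quadrilateral violates the four-point condition by an amount of order \<open>r h\<close>. Since \<open>0\<close>
  and \<open>h\<close> are in the support, this pattern on finitely many edges has positive probability, and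
  translating it to infinitely many disjoint places gives independent trials, so that almost surely
  it occurs somewhere, for every \<open>r\<close>.\<close>

section \<open>Edge paths and the adjacency relation\<close>

text \<open>In this form edge paths become powers and closures of a relation, and
  \<open>Restr\<close> confines them to a vertex set.\<close>

definition adj :: "'a set set \<Rightarrow> ('a \<times> 'a) set" where
  "adj E = {(x, y). {x, y} \<in> E}"

lemma mem_adj [simp]: "(x, y) \<in> adj E \<longleftrightarrow> {x, y} \<in> E"
  by (simp add: adj_def)

lemma sym_adj: "sym (adj E)"
  by (auto simp: sym_def insert_commute)

lemma sym_adj_Restr: "sym (Restr (adj E) A)"
  by (auto simp: sym_def insert_commute)

lemma path_edges_map:
  "path_edges (map f [m..<Suc (m + n)]) = map (\<lambda>i. {f i, f (Suc i)}) [m..<m + n]"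
proof (induction n arbitrary: m)
  case 0
  show ?case by simp
next
  case (Suc n)
  have "path_edges (map f [m..<Suc (m + Suc n)]) = path_edges (f m # f (Suc m) # map f [Suc (Suc m)..<Suc (m + Suc n)])"
    by (simp add: upt_rec)
  also have "\<dots> = {f m, f (Suc m)} # path_edges (map f [Suc m..<Suc (Suc m + n)])"
    by (simp add: upt_rec)
  also have "\<dots> = map (\<lambda>i. {f i, f (Suc i)}) [m..<m + Suc n]"
    by (subst Suc.IH) (simp add: upt_rec)
  finally show ?case .
qed

lemma chain_edge_path:
  assumes "\<And>i. i < n \<Longrightarrow> {f i, f (Suc i)} \<in> E"
  shows "map f [0..<Suc n] \<in> edge_paths E (f 0) (f n)"
  using assms path_edges_map[of f 0 n]
  by (auto simp: edge_paths_def hd_map last_map simp del: upt_Suc)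

lemma edge_path_rtrancl:
  assumes "\<gamma> \<in> edge_paths E x y" "set \<gamma> \<subseteq> A"
  shows "(x, y) \<in> (Restr (adj E) A)\<^sup>*"
  using assms
proof (induction \<gamma> arbitrary: x rule: path_edges.induct)
  case (1 u v us)
  then have "v # us \<in> edge_paths E v y" and "(x, v) \<in> Restr (adj E) A"
    by (auto simp: edge_paths_def)
  with 1 show ?case
    by (auto intro: converse_rtrancl_into_rtrancl)
qed (auto simp: edge_paths_def)

lemma rtrancl_chain:
  assumes "(x, y) \<in> (Restr (adj E) A)\<^sup>*"
  obtains f n where "f 0 = x" "f n = y" "\<And>i. i < n \<Longrightarrow> {f i, f (Suc i)} \<in> E"
    "\<And>i. i < n \<Longrightarrow> f i \<in> A" "\<And>i. i < n \<Longrightarrow> f (Suc i) \<in> A"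
  using assms unfolding rtrancl_power relpow_fun_conv by auto

text \<open>\<open>x \<in> A\<close> rules out the trivial path at a vertex outside
  \<open>A\<close>, which the reflexive closure would allow.\<close>

lemma rtrancl_edge_path:
  assumes "(x, y) \<in> (Restr (adj E) A)\<^sup>*" "x \<in> A"
  obtains \<gamma> where "\<gamma> \<in> edge_paths E x y" "set \<gamma> \<subseteq> A"
proof -
  obtain f n where f: "f 0 = x" "f n = y" "\<And>i. i < n \<Longrightarrow> {f i, f (Suc i)} \<in> E"
    "\<And>i. i < n \<Longrightarrow> f (Suc i) \<in> A"
    using rtrancl_chain[OF assms(1)] by metis
  have "f i \<in> A" if "i \<le> n" for i
    using that f(1) f(4)[of "i - 1"] assms(2) by (cases i) auto
  then have "set (map f [0..<Suc n]) \<subseteq> A"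
    by auto
  moreover have "map f [0..<Suc n] \<in> edge_paths E x y"
    using chain_edge_path[of n f E] f by auto
  ultimately show thesis
    by (rule that[rotated])
qed

section \<open>Bounds for the passage time\<close>

lemma path_length_nonneg:
  assumes "\<And>e. e \<in> E \<Longrightarrow> 0 \<le> \<omega> e" "\<gamma> \<in> edge_paths E x y"
  shows "0 \<le> path_length \<omega> \<gamma>"
  using assms unfolding path_length_def edge_paths_def by (intro sum_list_nonneg) auto

text \<open>Nonnegative edge lengths bound all path lengths below by 0; a real infimum of an
  unbounded set would give no information.\<close>

lemma fpp_dist_le_path_length:
  assumes "\<And>e. e \<in> E \<Longrightarrow> 0 \<le> \<omega> e" "\<gamma> \<in> edge_paths E x y"
  shows "fpp_dist E \<omega> x y \<le> path_length \<omega> \<gamma>"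
  unfolding fpp_dist_def
  by (rule cINF_lower[OF _ assms(2)]) (use path_length_nonneg[OF assms(1)] in \<open>auto intro!: bdd_belowI2[of _ 0]\<close>)

lemma fpp_dist_chain_le:
  fixes c :: real
  assumes "\<And>e. e \<in> E \<Longrightarrow> 0 \<le> \<omega> e"
    and "\<And>i. i < n \<Longrightarrow> {f i, f (Suc i)} \<in> E" "\<And>i. i < n \<Longrightarrow> \<omega> {f i, f (Suc i)} \<le> c"
  shows "fpp_dist E \<omega> (f 0) (f n) \<le> n * c"
proof -
  have "fpp_dist E \<omega> (f 0) (f n) \<le> path_length \<omega> (map f [0..<Suc n])"
    using assms by (intro fpp_dist_le_path_length chain_edge_path)
  also have "\<dots> = (\<Sum>i<n. \<omega> {f i, f (Suc i)})"
    using path_edges_map[of f 0 n]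
    by (simp add: path_length_def o_def sum_list_sum_nth atLeast0LessThan)
  also have "\<dots> \<le> n * c"
    using assms(3) sum_bounded_above[of "{..<n}" "\<lambda>i. \<omega> {f i, f (Suc i)}" c] by simp
  finally show ?thesis .
qed

text \<open>Telescoping along any path bounds its length below by the increase of the potential
  \<open>\<phi>\<close>; this is dual to exhibiting a short path. A path must exist because the real
  infimum of the empty set is not infinity.\<close>

lemma fpp_dist_ge_Lipschitz:
  fixes \<phi> :: "'a \<Rightarrow> real"
  assumes "\<And>u v. {u, v} \<in> E \<Longrightarrow> \<phi> v - \<phi> u \<le> \<omega> {u, v}" "edge_paths E x y \<noteq> {}"
  shows "\<phi> y - \<phi> x \<le> fpp_dist E \<omega> x y"
proof -
  have "\<phi> y - \<phi> x \<le> path_length \<omega> \<gamma>" if "\<gamma> \<in> edge_paths E x y" for \<gamma>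
    using that
  proof (induction \<gamma> arbitrary: x rule: path_edges.induct)
    case (1 u v us)
    then have "v # us \<in> edge_paths E v y" and uv: "{u, v} \<in> E" "x = u"
      by (auto simp: edge_paths_def)
    have "\<phi> y - \<phi> v \<le> path_length \<omega> (v # us)"
      by (rule 1(1)) fact
    with assms(1)[OF uv(1)] uv(2) show ?case
      by (simp add: path_length_def)
  qed (simp_all add: edge_paths_def path_length_def)
  then show ?thesis
    unfolding fpp_dist_def by (intro cINF_greatest assms)
qed

section \<open>Concatenation of paths and the triangle inequality\<close>

lemma path_edges_append:
  "\<gamma> \<noteq> [] \<Longrightarrow> path_edges (\<gamma> @ ys) = path_edges \<gamma> @ path_edges (last \<gamma> # ys)"
  by (induction \<gamma> rule: path_edges.induct) auto

lemma edge_paths_append: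
  assumes "\<gamma> \<in> edge_paths E x y" "y # \<gamma>' \<in> edge_paths E y z"
  shows "\<gamma> @ \<gamma>' \<in> edge_paths E x z"
    and "path_length \<omega> (\<gamma> @ \<gamma>') = path_length \<omega> \<gamma> + path_length \<omega> (y # \<gamma>')"
  using assms path_edges_append[of \<gamma> \<gamma>']
  by (auto simp: edge_paths_def path_length_def last_append split: if_splits)

lemma fpp_dist_triangle:
  assumes nonneg: "\<And>e. e \<in> E \<Longrightarrow> 0 \<le> \<omega> e"
    and ne: "edge_paths E x y \<noteq> {}" "edge_paths E y z \<noteq> {}"
  shows "fpp_dist E \<omega> x z \<le> fpp_dist E \<omega> x y + fpp_dist E \<omega> y z"
proof -
  have *: "fpp_dist E \<omega> x z \<le> path_length \<omega> \<gamma> + path_length \<omega> \<gamma>'"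
    if \<gamma>: "\<gamma> \<in> edge_paths E x y" and \<gamma>': "\<gamma>' \<in> edge_paths E y z" for \<gamma> \<gamma>'
  proof -
    obtain \<gamma>'' where "\<gamma>' = y # \<gamma>''"
      using \<gamma>' by (cases \<gamma>') (auto simp: edge_paths_def)
    with \<gamma> \<gamma>' show ?thesis
      using fpp_dist_le_path_length[OF nonneg edge_paths_append(1)[of \<gamma> E x y \<gamma>'' z]]
      by (simp add: edge_paths_append(2))
  qed
  \<comment> \<open>Minimising paths need not exist, so the infimum is taken over
    \<open>\<gamma>'\<close> with \<open>\<gamma>\<close> fixed, and then over
    \<open>\<gamma>\<close>.\<close>
  have "fpp_dist E \<omega> x z - fpp_dist E \<omega> y z \<le> path_length \<omega> \<gamma>" if "\<gamma> \<in> edge_paths E x y" for \<gamma>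
  proof -
    have "fpp_dist E \<omega> x z - path_length \<omega> \<gamma> \<le> fpp_dist E \<omega> y z"
      unfolding fpp_dist_def[of _ _ y z]
    proof (intro cINF_greatest ne)
      fix \<gamma>' assume "\<gamma>' \<in> edge_paths E y z"
      from *[OF that this] show "fpp_dist E \<omega> x z - path_length \<omega> \<gamma> \<le> path_length \<omega> \<gamma>'"
        by simp
    qed
    then show ?thesis by simp
  qed
  then have "fpp_dist E \<omega> x z - fpp_dist E \<omega> y z \<le> fpp_dist E \<omega> x y"
    unfolding fpp_dist_def[of _ _ x y] by (intro cINF_greatest ne)
  then show ?thesis by simp
qed

lemma edge_paths_rtrancl: "edge_paths E x y \<noteq> {} \<longleftrightarrow> (x, y) \<in> (adj E)\<^sup>*"
  using edge_path_rtrancl[of _ E x y UNIV] rtrancl_edge_path[of x y E UNIV]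
  by auto

section \<open>Combinatorial distance\<close>

text \<open>On a Cayley graph this is the word metric, valued in \<open>nat\<close>. For vertices
  that are not connected, \<open>LEAST\<close> ranges over an empty set, whence the connectivity
  assumptions in several lemmas below.\<close>

definition gdist :: "'a set set \<Rightarrow> 'a \<Rightarrow> 'a \<Rightarrow> nat" where
  "gdist E x y = (LEAST n. (x, y) \<in> adj E ^^ n)"

lemma gdist_le: "(x, y) \<in> adj E ^^ n \<Longrightarrow> gdist E x y \<le> n"
  unfolding gdist_def by (rule Least_le)

lemma relpow_gdist: "(x, y) \<in> (adj E)\<^sup>* \<Longrightarrow> (x, y) \<in> adj E ^^ gdist E x y"
  unfolding gdist_def rtrancl_power by (rule LeastI_ex)

lemma gdist_triangle:
  assumes "(x, y) \<in> (adj E)\<^sup>*" "(y, z) \<in> (adj E)\<^sup>*"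
  shows "gdist E x z \<le> gdist E x y + gdist E y z"
  using assms by (intro gdist_le) (auto simp: relpow_add intro: relpow_gdist)

lemma gdist_self [simp]: "gdist E x x = 0"
  using gdist_le[where n = 0 and x = x and y = x] by simp

lemma gdist_edge:
  assumes "(x, u) \<in> (adj E)\<^sup>*" "{u, v} \<in> E"
  shows "gdist E x v \<le> Suc (gdist E x u)"
  using assms by (intro gdist_le relpow_Suc_I[OF relpow_gdist]) auto

lemma relpow_adj_sym: "(x, y) \<in> adj E ^^ n \<Longrightarrow> (y, x) \<in> adj E ^^ n"
proof (induction n arbitrary: x y)
  case (Suc n)
  then obtain u where "(x, u) \<in> adj E ^^ n" "(u, y) \<in> adj E"
    by auto
  with Suc.IH[of x u] show ?case
    using sym_adj[of E] by (metis relpow_Suc_I2 symE)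
qed simp

lemma gdist_sym: "gdist E x y = gdist E y x"
  using relpow_adj_sym unfolding gdist_def by metis

section \<open>Geodesics\<close>

definition geodesic :: "'a set set \<Rightarrow> nat \<Rightarrow> (nat \<Rightarrow> 'a) \<Rightarrow> bool" where
  "geodesic E n a \<longleftrightarrow> (\<forall>i<n. {a i, a (Suc i)} \<in> E) \<and> (\<forall>i j. i \<le> j \<longrightarrow> j \<le> n \<longrightarrow> gdist E (a i) (a j) = j - i)"

lemma geodesic_exists:
  assumes "(x, y) \<in> (adj E)\<^sup>*"
  obtains a where "geodesic E (gdist E x y) a" "a 0 = x" "a (gdist E x y) = y"
proof -
  let ?n = "gdist E x y"
  obtain a where a: "a 0 = x" "a ?n = y" "\<And>i. i < ?n \<Longrightarrow> {a i, a (Suc i)} \<in> E"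
    using relpow_gdist[OF assms] by (auto simp: relpow_fun_conv)
  have chain: "(a i, a j) \<in> adj E ^^ (j - i)" if "i \<le> j" "j \<le> ?n" for i j
    unfolding relpow_fun_conv using that a(3) by (intro exI[of _ "\<lambda>k. a (i + k)"]) auto
  then have conn: "(a i, a j) \<in> (adj E)\<^sup>*" if "i \<le> j" "j \<le> ?n" for i j
    using that relpow_imp_rtrancl by blast
  have "gdist E (a i) (a j) = j - i" if "i \<le> j" "j \<le> ?n" for i j
  proof (rule antisym)
    show "gdist E (a i) (a j) \<le> j - i"
      using that chain by (intro gdist_le) auto
    \<comment> \<open>A shortcut between \<open>a i\<close> and \<open>a j\<close> would shorten the
      whole path, whose length is minimal.\<close>
    have "?n \<le> gdist E (a 0) (a i) + (gdist E (a i) (a j) + gdist E (a j) (a ?n))"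
      using gdist_triangle[of "a 0" "a i" E "a ?n"] gdist_triangle[of "a i" "a j" E "a ?n"]
        conn[of 0 i] conn[of i j] conn[of i ?n] conn[of j ?n] a(1,2) that by simp
    moreover have "gdist E (a 0) (a i) \<le> i" "gdist E (a j) (a ?n) \<le> ?n - j"
      using that chain[of 0 i] chain[of j ?n] by (auto intro!: gdist_le)
    ultimately show "j - i \<le> gdist E (a i) (a j)"
      using that by linarith
  qed
  with a show thesis
    by (intro that[of a]) (auto simp: geodesic_def)
qed


section \<open>A fat quadrilateral and the four-point condition\<close>

text \<open>The four points are the centre \<open>c\<close> of a geodesic of length \<open>2M\<close>, the two points \<open>p\<close>, \<open>q\<close> of
  it at distance \<open>r\<close> from \<open>c\<close>, and the cheap chain \<open>b\<close>, which acts as a single point \<open>W\<close> at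
  distance \<open>2r\<close> from \<open>c\<close>: they form a fat quadrilateral with sides \<open>r\<close> and diagonals \<open>2r\<close>.\<close>

lemma four_point_inequality:
  fixes \<omega> :: "'a set \<Rightarrow> real" and lo hi \<eta> \<delta> :: real
  assumes edges: "\<And>e. e \<in> E \<Longrightarrow> e \<subseteq> V"
    and conn: "\<And>x y. x \<in> V \<Longrightarrow> y \<in> V \<Longrightarrow> (x, y) \<in> (adj E)\<^sup>*"
    and nonneg: "\<And>e. e \<in> E \<Longrightarrow> 0 \<le> \<omega> e" "0 \<le> lo"
    and near: "\<And>u v. {u, v} \<in> E \<Longrightarrow> gdist E (a M) u < 2 * r \<Longrightarrow> lo \<le> \<omega> {u, v} \<and> \<omega> {u, v} \<le> hi"
    and geod: "geodesic E (2 * M) a" "a ` {..2 * M} \<subseteq> V" "2 * r \<le> M"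
    and b: "b 0 = a (M - 2 * r)" "b n = a (M + 2 * r)"
      "\<And>i. i < n \<Longrightarrow> {b i, b (Suc i)} \<in> E" "\<And>i. i < n \<Longrightarrow> \<omega> {b i, b (Suc i)} \<le> \<eta>"
    and hyp: "\<And>w x y z. w \<in> V \<Longrightarrow> x \<in> V \<Longrightarrow> y \<in> V \<Longrightarrow> z \<in> V \<Longrightarrow>
      gromov_product (fpp_dist E \<omega>) w x z \<ge>
        min (gromov_product (fpp_dist E \<omega>) w x y) (gromov_product (fpp_dist E \<omega>) w y z) - \<delta>"
  shows "4 * r * lo \<le> 2 * r * hi + n * \<eta> + 2 * \<delta>"
proof -
  let ?d = "fpp_dist E \<omega>"
  define c p q W where "c = a M" and "p = a (M - r)" and "q = a (M + r)" and "W = a (M + 2 * r)"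
  have V: "c \<in> V" "p \<in> V" "q \<in> V" "W \<in> V" "a (M - 2 * r) \<in> V"
    using geod by (auto simp: c_def p_def q_def W_def)
  have ga: "gdist E (a i) (a j) = j - i" if "i \<le> j" "j \<le> 2 * M" for i j
    using geod(1) that by (simp add: geodesic_def)
  have ends: "u \<in> V" "v \<in> V" if "{u, v} \<in> E" for u v
    using edges[OF that] by auto
  have paths: "edge_paths E x y \<noteq> {}" if "x \<in> V" "y \<in> V" for x y
    using conn[OF that] by (simp add: edge_paths_rtrancl)
  \<comment> \<open>Scaled by \<open>lo\<close>, \<open>\<psi>\<close> is a potential: an edge with
    an end inside the ball of radius \<open>2r\<close> costs at least \<open>lo\<close>, and
    \<open>\<psi>\<close> does not change along any other edge.\<close>
  have lower: "lo * (real (\<psi> y) - real (\<psi> x)) \<le> ?d x y"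
    if "x \<in> V" "y \<in> V" and \<psi>: "\<And>u v. {u, v} \<in> E \<Longrightarrow> \<psi> v \<le> Suc (\<psi> u)"
      "\<And>u v. {u, v} \<in> E \<Longrightarrow> 2 * r \<le> gdist E c u \<Longrightarrow> 2 * r \<le> gdist E c v \<Longrightarrow> \<psi> v = \<psi> u"
    for \<psi> :: "'a \<Rightarrow> nat" and x y
  proof -
    have "lo * \<psi> v - lo * \<psi> u \<le> \<omega> {u, v}" if uv: "{u, v} \<in> E" for u v
    proof (cases "gdist E c u < 2 * r \<or> gdist E c v < 2 * r")
      case True
      then have "lo \<le> \<omega> {u, v}"
        using near[of u v] near[of v u] uv by (auto simp: insert_commute c_def)
      moreover have "lo * (real (\<psi> v) - real (\<psi> u)) \<le> lo * 1"
        using \<psi>(1)[OF uv] nonneg(2) by (intro mult_left_mono) auto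
      ultimately show ?thesis
        by (simp add: algebra_simps)
    next
      case False
      then show ?thesis
        using \<psi>(2)[OF uv] nonneg(1)[OF uv] by simp
    qed
    then have "lo * \<psi> y - lo * \<psi> x \<le> ?d x y"
      using that(1,2) by (intro fpp_dist_ge_Lipschitz paths)
    then show ?thesis
      by (simp add: algebra_simps)
  qed
  \<comment> \<open>The potential is the depth below the sphere of radius \<open>2r\<close> around
    \<open>c\<close>: it is \<open>2r\<close> at \<open>c\<close> and 0 at \<open>W\<close>.\<close>
  have "lo * (real (2 * r - min (gdist E c c) (2 * r)) - real (2 * r - min (gdist E c W) (2 * r))) \<le> ?d W c"
  proof (rule lower)
    fix u v assume uv: "{u, v} \<in> E"
    have "gdist E c u \<le> Suc (gdist E c v)"
      using uv ends[OF uv] V by (intro gdist_edge conn) (auto simp: insert_commute)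
    then show "2 * r - min (gdist E c v) (2 * r) \<le> Suc (2 * r - min (gdist E c u) (2 * r))"
      by auto
  qed (use V in auto)
  moreover have "gdist E c W = 2 * r"
    using geod by (simp add: ga c_def W_def)
  ultimately have dWc: "2 * r * lo \<le> ?d W c"
    by (simp add: algebra_simps)
  have gcp: "gdist E c p = r"
    using geod by (subst gdist_sym) (simp add: ga c_def p_def)
  \<comment> \<open>Outside the ball, truncated subtraction makes the cap equal to \<open>r\<close>,
    and \<open>gdist E p\<close> is at least \<open>r\<close> there, so the potential is constantly
    \<open>r\<close> and detours gain nothing. It is 0 at \<open>p\<close> and \<open>2r\<close> at
    \<open>q\<close>.\<close>
  have "lo * (real (min (gdist E p q) (r + (2 * r - gdist E c q))) -
      real (min (gdist E p p) (r + (2 * r - gdist E c p)))) \<le> ?d p q"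
  proof (rule lower)
    fix u v assume uv: "{u, v} \<in> E"
    have "gdist E c u \<le> Suc (gdist E c v)" "gdist E p v \<le> Suc (gdist E p u)"
      using uv ends[OF uv] V by (auto intro!: gdist_edge conn simp: insert_commute)
    then show "min (gdist E p v) (r + (2 * r - gdist E c v))
        \<le> Suc (min (gdist E p u) (r + (2 * r - gdist E c u)))"
      by auto
    assume far: "2 * r \<le> gdist E c u" "2 * r \<le> gdist E c v"
    have "gdist E c u \<le> gdist E c p + gdist E p u" "gdist E c v \<le> gdist E c p + gdist E p v"
      using ends[OF uv] V by (auto intro!: gdist_triangle conn)
    then show "min (gdist E p v) (r + (2 * r - gdist E c v)) = min (gdist E p u) (r + (2 * r - gdist E c u))"
      using far gcp by auto
  qed (use V in auto)
  moreover have "gdist E p q = 2 * r" "gdist E c q = r"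
    using geod by (simp_all add: ga c_def p_def q_def)
  ultimately have dpq: "2 * r * lo \<le> ?d p q"
    by (simp add: algebra_simps)
  have step: "{a k, a (Suc k)} \<in> E" "\<omega> {a k, a (Suc k)} \<le> hi" if "M - 2 * r \<le> k" "k < M + 2 * r" for k
  proof -
    show E: "{a k, a (Suc k)} \<in> E"
      using geod that by (simp add: geodesic_def)
    \<comment> \<open>An end strictly inside the ball is \<open>a (Suc k)\<close> for
      \<open>k < M\<close> and \<open>a k\<close> otherwise.\<close>
    have "gdist E (a M) (a k) < 2 * r \<or> gdist E (a M) (a (Suc k)) < 2 * r"
      using that geod ga[of M k] ga[of "Suc k" M] gdist_sym[of E "a M" "a (Suc k)"] by (cases "k < M") auto
    then show "\<omega> {a k, a (Suc k)} \<le> hi"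
      using near[of "a k" "a (Suc k)"] near[of "a (Suc k)" "a k"] E by (auto simp: insert_commute)
  qed
  have up: "?d (a i) (a (i + k)) \<le> k * hi" if "M - 2 * r \<le> i" "i + k \<le> M + 2 * r" for i k
  proof -
    have "?d ((\<lambda>l. a (i + l)) 0) ((\<lambda>l. a (i + l)) k) \<le> k * hi"
      using that by (intro fpp_dist_chain_le nonneg) (use step in auto)
    then show ?thesis by simp
  qed
  \<comment> \<open>The geodesic is traversed backwards, as for \<open>?d q c\<close>;
    \<open>k \<le> i\<close> keeps \<open>i - k\<close> from being truncated.\<close>
  have down: "?d (a i) (a (i - k)) \<le> k * hi" if "M - 2 * r \<le> i - k" "i \<le> M + 2 * r" "k \<le> i" for i k
  proof -
    have "{a (i - l), a (i - Suc l)} \<in> E \<and> \<omega> {a (i - l), a (i - Suc l)} \<le> hi" if "l < k" for l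
      using step[of "i - Suc l"] that \<open>M - 2 * r \<le> i - k\<close> \<open>i \<le> M + 2 * r\<close> \<open>k \<le> i\<close>
      by (auto simp: insert_commute Suc_diff_Suc)
    then have "?d ((\<lambda>l. a (i - l)) 0) ((\<lambda>l. a (i - l)) k) \<le> k * hi"
      by (intro fpp_dist_chain_le nonneg) auto
    then show ?thesis by simp
  qed
  have dpc: "?d p c \<le> r * hi"
    using up[of "M - r" r] geod by (simp add: p_def c_def)
  have dqc: "?d q c \<le> r * hi"
    using down[of "M + r" r] by (simp add: q_def c_def)
  have dWq: "?d W q \<le> r * hi"
  proof -
    have "M + 2 * r - r = M + r" "M - 2 * r \<le> M + r"
      by simp_all
    then show ?thesis
      using down[of "M + 2 * r" r] by (simp add: q_def W_def add.commute)
  qed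
  \<comment> \<open>The route from \<open>p\<close> to \<open>W\<close> goes outwards to the start
    of \<open>b\<close> and then along \<open>b\<close>, at total cost at most
    \<open>n * \<eta>\<close> for the second stretch.\<close>
  have "?d p W \<le> ?d p (a (M - 2 * r)) + ?d (a (M - 2 * r)) W"
    using V by (intro fpp_dist_triangle nonneg paths)
  moreover have "?d p (a (M - 2 * r)) \<le> r * hi"
  proof -
    have "M - r - r = M - 2 * r"
      by simp
    then show ?thesis
      using down[of "M - r" r] geod(3) by (simp only: p_def)
  qed
  moreover have "?d (b 0) (b n) \<le> n * \<eta>"
    by (intro fpp_dist_chain_le nonneg b)
  ultimately have dpW: "?d p W \<le> r * hi + n * \<eta>"
    by (simp add: b W_def)
  have "0 \<le> n * \<eta>"
    using b(3,4) nonneg(1) by (cases n) (auto intro!: mult_nonneg_nonneg intro: order_trans)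
  \<comment> \<open>Whichever product attains the minimum, a distance to the base point
    \<open>c\<close> cancels: the diagonals \<open>?d p q\<close> and \<open>?d W c\<close> are
    together at most two opposite sides plus \<open>2 * \<delta>\<close>. Only the pair with
    \<open>?d p W\<close> brings in \<open>n * \<eta>\<close>; its nonnegativity covers the other
    pair.\<close>
  then show ?thesis
    using hyp[of c p W q] V dWc dpq dpc dqc dWq dpW
    by (auto simp: gromov_product_def min_def field_simps split: if_splits)
qed

section \<open>Independent patterns\<close>

text \<open>Copies of the pattern on disjoint coordinates are independent with a common probability
  \<open>p > 0\<close>, so \<open>n\<close> of them all fail with probability
  \<open>(1 - p) ^ n\<close>, which tends to 0. Injectivity of \<open>case_prod \<phi>\<close> says
  both that each copy is faithful and that the copies are disjoint.\<close>

lemma AE_PiM_pattern: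
  fixes \<rho> :: "'b measure" and \<phi> :: "'g \<Rightarrow> 'e \<Rightarrow> 'i"
  assumes "prob_space \<rho>" and fin: "finite J" and Y: "\<And>e. e \<in> J \<Longrightarrow> Y e \<in> sets \<rho>"
    and pos: "\<And>e. e \<in> J \<Longrightarrow> measure \<rho> (Y e) > 0"
    and sub: "\<And>g e. g \<in> A \<Longrightarrow> e \<in> J \<Longrightarrow> \<phi> g e \<in> I"
    and many: "\<And>N. \<exists>T\<subseteq>A. finite T \<and> card T = N \<and> inj_on (case_prod \<phi>) (T \<times> J)"
  shows "AE \<omega> in PiM I (\<lambda>_. \<rho>). \<exists>g\<in>A. \<forall>e\<in>J. \<omega> (\<phi> g e) \<in> Y e"
proof -
  interpret \<rho>: prob_space \<rho> by fact
  interpret product_prob_space "\<lambda>_. \<rho>" I by standard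
  let ?M = "PiM I (\<lambda>_. \<rho>)"
  define B where "B g = {\<omega> \<in> space ?M. \<forall>e\<in>J. \<omega> (\<phi> g e) \<in> Y e}" for g
  define p where "p = (\<Prod>e\<in>J. measure \<rho> (Y e))"
  have p: "0 < p" "p \<le> 1"
    unfolding p_def using pos by (auto intro!: prod_pos prod_le_1)
  have B_sets: "B g \<in> sets ?M" if "g \<in> A" for g
  proof -
    have "(\<lambda>\<omega>. \<omega> (\<phi> g e)) -` Y e \<inter> space ?M \<in> sets ?M" if "e \<in> J" for e
      using sub[OF \<open>g \<in> A\<close> that] Y[OF that] by (intro measurable_sets[OF measurable_component_singleton])
    then show ?thesis
      unfolding B_def by (intro sets.sets_Collect_finite_All fin) (simp add: vimage_def Int_def conj_commute)
  qed
  have prob_INT: "P.prob (\<Inter>g\<in>L. B g) = p ^ card L"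
    if L: "L \<noteq> {}" "L \<subseteq> A" "finite L" "inj_on (case_prod \<phi>) (L \<times> J)" for L
  proof -
    let ?K = "case_prod \<phi> ` (L \<times> J)"
    \<comment> \<open>By injectivity each coordinate in \<open>?K\<close> comes from a single pair
      \<open>(g, e)\<close>, so the intersection of the events becomes one cylinder set with sides
      \<open>X\<close>.\<close>
    define X where "X i = Y (snd (inv_into (L \<times> J) (case_prod \<phi>) i))" for i
    have X: "X (\<phi> g e) = Y e" if "g \<in> L" "e \<in> J" for g e
      using inv_into_f_f[OF L(4), of "(g, e)"] that by (simp add: X_def)
    have "(\<Inter>g\<in>L. B g) = prod_emb I (\<lambda>_. \<rho>) ?K (Pi\<^sub>E ?K X)"
      using L(1) sub L(2) by (fastforce simp: B_def prod_emb_def X space_PiM PiE_iff Pi_iff restrict_def extensional_def)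
    then have "P.prob (\<Inter>g\<in>L. B g) = (\<Prod>i\<in>?K. measure \<rho> (X i))"
      using fin L sub Y by (simp only:) (rule measure_PiM_emb, auto simp: X)
    also have "\<dots> = (\<Prod>(g, e)\<in>L \<times> J. measure \<rho> (Y e))"
      by (subst prod.reindex[OF L(4)]) (auto intro!: prod.cong simp: X)
    also have "\<dots> = p ^ card L"
      by (simp add: prod.cartesian_product[symmetric] p_def)
    finally show ?thesis .
  qed
  \<comment> \<open>\<open>A\<close> may be uncountable, so the event that every copy fails need not
    be measurable; it is enclosed in measurable sets of small probability.\<close>
  have "\<exists>N. N \<in> sets ?M \<and> P.prob N \<le> (1 - p) ^ n \<and>
      {\<omega> \<in> space ?M. \<not> (\<exists>g\<in>A. \<forall>e\<in>J. \<omega> (\<phi> g e) \<in> Y e)} \<subseteq> N" for n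
  proof -
    \<comment> \<open>\<open>Suc n\<close> keeps \<open>T\<close> nonempty, as the intersections
      over \<open>T\<close> require; the surplus factor \<open>1 - p\<close> is dropped at the
      end.\<close>
    obtain T where T: "T \<subseteq> A" "finite T" "card T = Suc n" "inj_on (case_prod \<phi>) (T \<times> J)"
      using many by metis
    have single: "P.prob (B g) = p" if "g \<in> T" for g
      using prob_INT[of "{g}"] that T inj_on_subset[OF T(4), of "{g} \<times> J"] by auto
    have "P.indep_sets (\<lambda>g. {B g}) T"
    proof (rule P.indep_setsI)
      fix A' L assume L: "L \<noteq> {}" "L \<subseteq> T" "finite L" "\<forall>j\<in>L. A' j \<in> {B j}"
      then have "P.prob (\<Inter>j\<in>L. A' j) = p ^ card L"
        using prob_INT[of L] T inj_on_subset[OF T(4), of "L \<times> J"] by auto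
      then show "P.prob (\<Inter>j\<in>L. A' j) = (\<Prod>j\<in>L. P.prob (A' j))"
        using L single by (simp add: subset_iff)
    qed (use B_sets T in auto)
    \<comment> \<open>Passing to the generated sigma-algebras makes the complements independent too,
      that is, the failures of the copies.\<close>
    then have ind: "P.indep_sets (\<lambda>g. sigma_sets (space ?M) {B g}) T"
      by (rule P.indep_sets_sigma) (simp add: Int_stable_def)
    have "P.prob (\<Inter>g\<in>T. space ?M - B g) = (\<Prod>g\<in>T. P.prob (space ?M - B g))"
      using T by (intro P.indep_setsD[OF ind]) (auto intro: sigma_sets.intros)
    also have "\<dots> = (1 - p) ^ Suc n"
      using T B_sets single by (simp add: P.prob_compl subset_iff)
    also have "\<dots> \<le> (1 - p) ^ n"
      using p by (simp add: mult_left_le_one_le)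
    finally have "P.prob (\<Inter>g\<in>T. space ?M - B g) \<le> (1 - p) ^ n" .
    moreover have "(\<Inter>g\<in>T. space ?M - B g) \<in> sets ?M"
      using T B_sets by (intro sets.finite_INT) auto
    moreover have "{\<omega> \<in> space ?M. \<not> (\<exists>g\<in>A. \<forall>e\<in>J. \<omega> (\<phi> g e) \<in> Y e)} \<subseteq> (\<Inter>g\<in>T. space ?M - B g)"
      using T by (auto simp: B_def)
    ultimately show ?thesis by blast
  qed
  then have "\<forall>n. \<exists>N. N \<in> sets ?M \<and> P.prob N \<le> (1 - p) ^ n \<and>
      {\<omega> \<in> space ?M. \<not> (\<exists>g\<in>A. \<forall>e\<in>J. \<omega> (\<phi> g e) \<in> Y e)} \<subseteq> N" ..
  from choice[OF this] obtain N where N: "N n \<in> sets ?M" "P.prob (N n) \<le> (1 - p) ^ n"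
    "{\<omega> \<in> space ?M. \<not> (\<exists>g\<in>A. \<forall>e\<in>J. \<omega> (\<phi> g e) \<in> Y e)} \<subseteq> N n" for n
    by auto
  have "P.prob (\<Inter>n. N n) \<le> (1 - p) ^ n" for n
    using P.finite_measure_mono[of "\<Inter>n. N n" "N n"] N(1,2)[of n] by (simp add: INT_lower)
  moreover have "(\<lambda>n. (1 - p) ^ n) \<longlonglongrightarrow> 0"
    using p by (intro LIMSEQ_realpow_zero) auto
  ultimately have "P.prob (\<Inter>n. N n) \<le> 0"
    by (intro LIMSEQ_le_const) auto
  then have "(\<Inter>n. N n) \<in> null_sets ?M"
    using N(1) by (intro null_setsI) (auto simp: P.emeasure_eq_measure measure_le_0_iff)
  then show ?thesis
    by (rule AE_I') (use N(3) in blast)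
qed


section \<open>Cayley graphs\<close>

locale cayley_graph = group G for G (structure) +
  fixes S :: "'a set"
  assumes gens: "fin_sym_gen_set G S"
begin

abbreviation "E \<equiv> cayley_edges G S"
abbreviation "V \<equiv> carrier G"

lemma S_props: "finite S" "S \<subseteq> V" "s \<in> S \<Longrightarrow> inv s \<in> S" "generate G S = V"
  using gens by (auto simp: fin_sym_gen_set_def)

text \<open>Reading an edge from its other end replaces \<open>s\<close> by \<open>inv s\<close>,
  which lies in \<open>S\<close> by symmetry.\<close>

lemma edge_iff: "{x, y} \<in> E \<longleftrightarrow> x \<in> V \<and> y \<in> V \<and> (\<exists>s\<in>S. s \<noteq> \<one> \<and> y = x \<otimes> s)"
proof
  assume "{x, y} \<in> E"
  then obtain u s where us: "{x, y} = {u, u \<otimes> s}" "u \<in> V" "s \<in> S" "s \<noteq> \<one>"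
    by (auto simp: cayley_edges_def)
  then have s: "s \<in> V" "inv s \<in> S" "inv s \<noteq> \<one>" "u = (u \<otimes> s) \<otimes> inv s"
    using S_props by (auto simp: inv_solve_right' m_assoc inv_eq_1_iff)
  from us(1) consider "x = u" "y = u \<otimes> s" | "x = u \<otimes> s" "y = u"
    by (auto simp: doubleton_eq_iff)
  then show "x \<in> V \<and> y \<in> V \<and> (\<exists>s\<in>S. s \<noteq> \<one> \<and> y = x \<otimes> s)"
  proof cases
    case 1
    with us s show ?thesis by auto
  next
    case 2
    then have "y = x \<otimes> inv s"
      using s(4) by simp
    with 2 us(2) s(1-3) show ?thesis by blast
  qed
qed (auto simp: cayley_edges_def)

lemma edge_subset: "e \<in> E \<Longrightarrow> e \<subseteq> V"
  using S_props(2) by (auto simp: cayley_edges_def)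

text \<open>Left translations commute with the right multiplications that define the edges, so they
  act by graph automorphisms.\<close>

lemma edge_translate: "g \<in> V \<Longrightarrow> {x, y} \<in> E \<Longrightarrow> {g \<otimes> x, g \<otimes> y} \<in> E"
  using S_props(2) by (fastforce simp: edge_iff m_assoc)

lemma adj_relpow_translate:
  assumes "g \<in> V"
  shows "(x, y) \<in> adj E ^^ n \<Longrightarrow> (g \<otimes> x, g \<otimes> y) \<in> adj E ^^ n"
proof (induction n arbitrary: y)
  case (Suc n)
  then obtain z where "(x, z) \<in> adj E ^^ n" "{z, y} \<in> E"
    by auto
  with Suc.IH edge_translate[OF assms] show ?case
    by (intro relpow_Suc_I[of _ "g \<otimes> z"]) auto
qed simp

lemma gdist_translate:
  assumes "g \<in> V" "x \<in> V" "y \<in> V"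
  shows "gdist E (g \<otimes> x) (g \<otimes> y) = gdist E x y"
proof -
  have "(g \<otimes> x, g \<otimes> y) \<in> adj E ^^ n \<longleftrightarrow> (x, y) \<in> adj E ^^ n" for n
    using adj_relpow_translate[of g x y n] adj_relpow_translate[of "inv g" "g \<otimes> x" "g \<otimes> y" n] assms
    by (auto simp: m_assoc[symmetric])
  then show ?thesis
    by (simp add: gdist_def)
qed

lemma connected_one: "x \<in> V \<Longrightarrow> (\<one>, x) \<in> (adj E)\<^sup>*"
proof -
  have gen: "(\<one>, s) \<in> (adj E)\<^sup>*" if "s \<in> S" for s
  proof (cases "s = \<one>")
    case False
    with that S_props(2) have "(\<one>, s) \<in> adj E"
      by (auto simp: edge_iff subset_iff)
    then show ?thesis ..
  qed simp
  assume "x \<in> V"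
  then have "x \<in> generate G S"
    by (simp add: S_props)
  then show ?thesis
  proof induction
    case (eng h1 h2)
    then have h: "h1 \<in> V" "h2 \<in> V"
      using S_props(4) by auto
    obtain n where "(\<one>, h2) \<in> adj E ^^ n"
      using eng.IH by (auto simp: rtrancl_power)
    \<comment> \<open>A path from \<open>\<one>\<close> to \<open>h2\<close>, translated by
      \<open>h1\<close>, prolongs a path that ends at \<open>h1\<close>.\<close>
    from adj_relpow_translate[OF h(1) this] have "(h1, h1 \<otimes> h2) \<in> (adj E)\<^sup>*"
      using h by (auto simp: rtrancl_power)
    with eng.IH show ?case
      by (meson rtrancl_trans)
  qed (use gen S_props in auto)
qed

lemma connected: "x \<in> V \<Longrightarrow> y \<in> V \<Longrightarrow> (x, y) \<in> (adj E)\<^sup>*"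
  using connected_one sym_rtrancl[OF sym_adj[of E]] by (meson rtrancl_trans symD)

lemma finite_ball: "finite {x \<in> V. gdist E \<one> x < n}"
proof -
  have fin: "finite {x. (\<one>, x) \<in> adj E ^^ k}" for k
  proof (induction k)
    case (Suc k)
    have "{x. (\<one>, x) \<in> adj E ^^ Suc k} \<subseteq> (\<lambda>(x, s). x \<otimes> s) ` ({x. (\<one>, x) \<in> adj E ^^ k} \<times> S)"
      by (auto simp: edge_iff)
    then show ?case
      by (rule finite_subset) (use Suc S_props(1) in auto)
  qed simp
  have "{x \<in> V. gdist E \<one> x < n} \<subseteq> (\<Union>k<n. {x. (\<one>, x) \<in> adj E ^^ k})"
    using relpow_gdist[OF connected_one] by auto
  then show ?thesis
    using fin by (auto intro: finite_subset)
qed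

text \<open>Balls are finite, so an infinite group has elements arbitrarily far from
  \<open>\<one>\<close>. The first \<open>2 * M\<close> steps of a geodesic to one of them are
  translated so that their midpoint becomes \<open>\<one>\<close>.\<close>

lemma centred_geodesic_exists:
  assumes "infinite V"
  obtains a where "geodesic E (2 * M) a" "a ` {..2 * M} \<subseteq> V" "a M = \<one>"
proof -
  obtain x where x: "x \<in> V" "2 * M \<le> gdist E \<one> x"
    using assms finite_ball[of "2 * M"] by (metis (mono_tags, lifting) finite_subset mem_Collect_eq not_le subsetI)
  obtain f where f: "geodesic E (gdist E \<one> x) f" "f (gdist E \<one> x) = x"
    using geodesic_exists[OF connected_one[OF x(1)]] by metis
  have fV: "f i \<in> V" if "i \<le> 2 * M" for i
  proof (cases "i < gdist E \<one> x")
    case True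
    then show ?thesis using f(1) by (auto simp: geodesic_def edge_iff)
  next
    case False
    then have "i = gdist E \<one> x"
      using x that by linarith
    then show ?thesis using f(2) x by simp
  qed
  show thesis
  proof (rule that[of "\<lambda>i. inv (f M) \<otimes> f i"])
    show "geodesic E (2 * M) (\<lambda>i. inv (f M) \<otimes> f i)"
      using f(1) x(2) fV by (simp add: geodesic_def edge_translate gdist_translate)
  qed (use fV in auto)
qed

text \<open>Translates are chosen greedily with disjoint vertex sets. They supply the independent
  copies for \<open>AE_PiM_pattern\<close>.\<close>

lemma disjoint_translates:
  assumes "infinite V" "finite J" "J \<subseteq> E"
  shows "\<exists>T\<subseteq>V. finite T \<and> card T = N \<and> inj_on (\<lambda>(g, e). (\<otimes>) g ` e) (T \<times> J)"
proof -
  have W: "finite (\<Union>J)" "\<Union>J \<subseteq> V"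
    using assms edge_subset by (auto simp: cayley_edges_def)
  have "\<exists>T\<subseteq>V. finite T \<and> card T = N \<and>
      (\<forall>g\<in>T. \<forall>g'\<in>T. g \<noteq> g' \<longrightarrow> (\<forall>w\<in>\<Union>J. \<forall>w'\<in>\<Union>J. g \<otimes> w \<noteq> g' \<otimes> w'))"
  proof (induction N)
    case (Suc N)
    then obtain T where T: "T \<subseteq> V" "finite T" "card T = N"
      "\<And>g g' w w'. g \<in> T \<Longrightarrow> g' \<in> T \<Longrightarrow> g \<noteq> g' \<Longrightarrow> w \<in> \<Union>J \<Longrightarrow> w' \<in> \<Union>J \<Longrightarrow> g \<otimes> w \<noteq> g' \<otimes> w'"
      by blast
    \<comment> \<open>A collision of \<open>g \<otimes> w\<close> with
      \<open>g' \<otimes> w'\<close> determines \<open>g\<close>, so only finitely many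
      \<open>g\<close> are excluded.\<close>
    let ?bad = "(\<lambda>(g, w, w'). g \<otimes> w' \<otimes> inv w) ` (T \<times> \<Union>J \<times> \<Union>J)"
    have "finite (T \<union> ?bad)"
      using T W by auto
    then obtain g where g: "g \<in> V" "g \<notin> T \<union> ?bad"
      using assms(1) by (meson finite_subset subsetI)
    have new: "g \<otimes> w \<noteq> g' \<otimes> w'" if "g' \<in> T" "w \<in> \<Union>J" "w' \<in> \<Union>J" for g' w w'
    proof
      assume eq: "g \<otimes> w = g' \<otimes> w'"
      have "w \<in> V" "w' \<in> V" "g' \<in> V"
        using that W T by auto
      then have "g = g' \<otimes> w' \<otimes> inv w"
        using g by (simp add: eq[symmetric] m_assoc)
      with that have "g \<in> ?bad"
        by (intro image_eqI[of _ _ "(g', w, w')"]) auto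
      with g show False by simp
    qed
    show ?case
    proof (intro exI[of _ "insert g T"] conjI ballI impI)
      fix h h' w w' assume "h \<in> insert g T" "h' \<in> insert g T" "h \<noteq> h'" "w \<in> \<Union>J" "w' \<in> \<Union>J"
      then show "h \<otimes> w \<noteq> h' \<otimes> w'"
        using T(4)[of h h' w w'] new[of h w' w] new[of h' w w'] by (metis insert_iff)
    qed (use T g in auto)
  qed auto
  then obtain T where T: "T \<subseteq> V" "finite T" "card T = N"
    "\<And>g g' w w'. g \<in> T \<Longrightarrow> g' \<in> T \<Longrightarrow> g \<noteq> g' \<Longrightarrow> w \<in> \<Union>J \<Longrightarrow> w' \<in> \<Union>J \<Longrightarrow> g \<otimes> w \<noteq> g' \<otimes> w'"
    by blast
  have "inj_on (\<lambda>(g, e). (\<otimes>) g ` e) (T \<times> J)"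
  proof (rule inj_onI, clarify)
    fix g e g' e' assume *: "g \<in> T" "e \<in> J" "g' \<in> T" "e' \<in> J" "(\<otimes>) g ` e = (\<otimes>) g' ` e'"
    obtain w where "w \<in> e"
      using * assms(3) by (fastforce simp: cayley_edges_def)
    moreover then obtain w' where "w' \<in> e'" "g \<otimes> w = g' \<otimes> w'"
      using *(5) by blast
    ultimately have g: "g = g'"
      using T(4)[of g g' w w'] * by blast
    have "inj_on ((\<otimes>) g) V"
      using T * by (intro inj_onI) auto
    moreover have "e \<subseteq> V" "e' \<subseteq> V"
      using * assms(3) edge_subset by auto
    ultimately show "g = g' \<and> e = e'"
      using g * inj_on_image_eq_iff by metis
  qed
  with T show ?thesis by blast
qed

section \<open>Connectivity outside finite sets from one-endedness\<close>

lemma components_outside_Image: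
  assumes "x \<in> V - K"
  shows "{y. \<exists>\<gamma>\<in>edge_paths E x y. set \<gamma> \<subseteq> V - K} = (Restr (adj E) (V - K))\<^sup>* `` {x}"
proof (intro equalityI subsetI)
  fix y assume "y \<in> (Restr (adj E) (V - K))\<^sup>* `` {x}"
  then obtain \<gamma> where "\<gamma> \<in> edge_paths E x y" "set \<gamma> \<subseteq> V - K"
    using rtrancl_edge_path[OF _ assms, of y E] by auto
  then show "y \<in> {y. \<exists>\<gamma>\<in>edge_paths E x y. set \<gamma> \<subseteq> V - K}"
    by blast
qed (auto intro: edge_path_rtrancl)

lemma one_ended_infinite:
  assumes "one_ended V E"
  shows "infinite V"
proof -
  obtain C where C: "C \<in> components_outside V E {}" "infinite C"
    using assms unfolding one_ended_def by blast
  have "C \<subseteq> V"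
    using C(1) last_in_set by (fastforce simp: components_outside_def edge_paths_def)
  with C show ?thesis
    using infinite_super by blast
qed

text \<open>Removing a finite nonempty set leaves finitely many components, since each contains one
  of the finitely many neighbours of that set. Deleting the finite components as well leaves only
  the unique infinite one.\<close>

lemma one_ended_cofinite:
  assumes "one_ended V E" "finite K" "K \<subseteq> V"
  shows "\<exists>F. finite F \<and> (\<forall>x\<in>V - F. \<forall>y\<in>V - F. (x, y) \<in> (Restr (adj E) (V - K))\<^sup>*)"
proof -
  \<comment> \<open>Adding \<open>\<one>\<close> makes the removed set nonempty: a path from an
    outside vertex to \<open>\<one>\<close> must enter it, and the vertex before the first entry
    lies in \<open>N\<close>.\<close>
  define K1 where "K1 = insert \<one> K"
  define R where "R = Restr (adj E) (V - K1)"
  define N where "N = (\<lambda>(k, s). k \<otimes> s) ` (K1 \<times> S) \<inter> (V - K1)"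
  define F where "F = K1 \<union> (\<Union>n\<in>{n\<in>N. finite (R\<^sup>* `` {n})}. R\<^sup>* `` {n})"
  have symR: "sym (R\<^sup>*)"
    unfolding R_def by (intro sym_rtrancl sym_adj_Restr)
  have K1: "finite K1" "K1 \<subseteq> V"
    using assms by (auto simp: K1_def)
  have reach: "x \<in> V - K1 \<Longrightarrow> \<exists>n\<in>N. (x, n) \<in> R\<^sup>*" if "(x, \<one>) \<in> (adj E)\<^sup>*" for x
    using that
  proof (induction rule: converse_rtrancl_induct)
    case base
    then show ?case by (simp add: K1_def)
  next
    case (step x z)
    then have E: "{x, z} \<in> E" "{z, x} \<in> E"
      by (auto simp: insert_commute)
    show ?case
    proof (cases "z \<in> K1")
      case True
      with E(2) step.prems have "x \<in> N"
        by (auto simp: N_def edge_iff)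
      then show ?thesis by blast
    next
      case False
      then have "(x, z) \<in> R" "z \<in> V - K1"
        using E step.prems by (auto simp: R_def edge_iff)
      then show ?thesis
        using step.IH by (meson converse_rtrancl_into_rtrancl)
    qed
  qed
  have inf: "\<exists>n\<in>N. (x, n) \<in> R\<^sup>* \<and> R\<^sup>* `` {n} \<in> components_outside V E K1 \<and> infinite (R\<^sup>* `` {n})"
    if x: "x \<in> V - F" for x
  proof -
    obtain n where n: "n \<in> N" "(x, n) \<in> R\<^sup>*"
      using reach[OF connected[OF _ one_closed], of x] x by (auto simp: F_def)
    then have "(n, x) \<in> R\<^sup>*"
      using symR by (meson symD)
    then have "infinite (R\<^sup>* `` {n})"
      using x n by (auto simp: F_def)
    moreover have "R\<^sup>* `` {n} \<in> components_outside V E K1"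
      using n(1) components_outside_Image[of n K1] by (auto simp: components_outside_def R_def N_def)
    ultimately show ?thesis
      using n by blast
  qed
  have uniq: "\<exists>!C. C \<in> components_outside V E K1 \<and> infinite C"
    using assms(1) K1 by (auto simp: one_ended_def)
  have "(x, y) \<in> R\<^sup>*" if xy: "x \<in> V - F" "y \<in> V - F" for x y
  proof -
    obtain m n where "(x, m) \<in> R\<^sup>*" "(y, n) \<in> R\<^sup>*" "R\<^sup>* `` {m} = R\<^sup>* `` {n}"
      using inf[OF xy(1)] inf[OF xy(2)] uniq by metis
    moreover then have "(n, y) \<in> R\<^sup>*"
      using symR by (meson symD)
    ultimately show ?thesis
      by (blast intro: rtrancl_trans)
  qed
  moreover have "R\<^sup>* \<subseteq> (Restr (adj E) (V - K))\<^sup>*"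
    unfolding R_def K1_def by (intro rtrancl_mono) auto
  moreover have "finite F"
    using K1 S_props(1) by (auto simp: F_def N_def)
  ultimately show ?thesis
    by blast
qed

text \<open>One-endedness is given for some generating set \<open>S'\<close>. An edge of its Cayley graph outside a
  large enough set \<open>K'\<close> is replaced by a path with respect to \<open>S\<close> that avoids \<open>K\<close>.\<close>

lemma one_ended_cofinite_gens:
  assumes "cayley_graph G S'" "one_ended V (cayley_edges G S')" "finite K" "K \<subseteq> V"
  shows "\<exists>F. finite F \<and> (\<forall>x\<in>V - F. \<forall>y\<in>V - F. (x, y) \<in> (Restr (adj E) (V - K))\<^sup>*)"
proof -
  interpret S': cayley_graph G S' by fact
  \<comment> \<open>\<open>D\<close> confines the steps of some \<open>S\<close>-path from
    \<open>\<one>\<close> to \<open>x\<close>; it is used for the finitely many generators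
    \<open>x\<close> in \<open>S'\<close>.\<close>
  have "\<exists>D. finite D \<and> D \<subseteq> V \<and> (\<one>, x) \<in> (Restr (adj E) D)\<^sup>*" if "x \<in> V" for x
    using connected_one[OF that]
  proof induction
    case base
    show ?case by (intro exI[of _ "{}"]) auto
  next
    case (step y z)
    then obtain D where D: "finite D" "D \<subseteq> V" "(\<one>, y) \<in> (Restr (adj E) D)\<^sup>*"
      by blast
    have "(Restr (adj E) D)\<^sup>* \<subseteq> (Restr (adj E) (D \<union> {y, z}))\<^sup>*"
      by (intro rtrancl_mono) auto
    moreover have "(y, z) \<in> Restr (adj E) (D \<union> {y, z})"
      using step by auto
    ultimately have "(\<one>, z) \<in> (Restr (adj E) (D \<union> {y, z}))\<^sup>*"
      using D(3) by (meson rtrancl.rtrancl_into_rtrancl subsetD)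
    moreover have "y \<in> V" "z \<in> V"
      using step by (auto simp: edge_iff)
    ultimately show ?case
      using D by (intro exI[of _ "D \<union> {y, z}"]) auto
  qed
  then obtain D where D: "\<And>x. x \<in> V \<Longrightarrow> finite (D x) \<and> D x \<subseteq> V \<and> (\<one>, x) \<in> (Restr (adj E) (D x))\<^sup>*"
    by metis
  \<comment> \<open>If \<open>x \<otimes> d = k\<close> lies in \<open>K\<close>, then
    \<open>x = k \<otimes> inv d\<close>. Hence off \<open>K'\<close> the paths translated by
    \<open>x\<close> avoid \<open>K\<close>.\<close>
  define K' where "K' = (\<lambda>(k, d). k \<otimes> inv d) ` (K \<times> (\<Union>s\<in>S'. D s))"
  have K': "finite K'" "K' \<subseteq> V"
    using assms(3,4) D S'.S_props(1,2) by (auto simp: K'_def subset_iff)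
  obtain F where F: "finite F" "\<And>x y. x \<in> V - F \<Longrightarrow> y \<in> V - F \<Longrightarrow> (x, y) \<in> (Restr (adj S'.E) (V - K'))\<^sup>*"
    using S'.one_ended_cofinite[OF assms(2) K'] by blast
  have "Restr (adj S'.E) (V - K') \<subseteq> (Restr (adj E) (V - K))\<^sup>*"
  proof clarify
    fix x y assume x: "x \<in> V" "x \<notin> K'" and "(x, y) \<in> adj S'.E"
    then obtain s where s: "s \<in> S'" "y = x \<otimes> s" "s \<in> V"
      using S'.S_props(2) by (auto simp: S'.edge_iff)
    have avoid: "x \<otimes> d \<in> V - K" if "d \<in> D s" for d
    proof -
      have d: "d \<in> V"
        using that D s by auto
      have "x \<otimes> d \<notin> K"
      proof
        assume "x \<otimes> d \<in> K"
        with that s have "x \<otimes> d \<otimes> inv d \<in> K'"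
          unfolding K'_def by (intro image_eqI[of _ _ "(x \<otimes> d, d)"]) auto
        with x d show False by (simp add: m_assoc)
      qed
      with x d show ?thesis by simp
    qed
    have "(\<one>, s) \<in> (Restr (adj E) (D s))\<^sup>*"
      using D s by blast
    then have "(x \<otimes> \<one>, x \<otimes> s) \<in> (Restr (adj E) (V - K))\<^sup>*"
    proof induction
      case (step u v)
      then have "(x \<otimes> u, x \<otimes> v) \<in> Restr (adj E) (V - K)"
        using avoid[of u] avoid[of v] edge_translate[OF x(1), of u v] by auto
      with step.IH show ?case
        by (rule rtrancl_into_rtrancl)
    qed auto
    with x s show "(x, y) \<in> (Restr (adj E) (V - K))\<^sup>*"
      by simp
  qed
  then have "(Restr (adj S'.E) (V - K'))\<^sup>* \<subseteq> (Restr (adj E) (V - K))\<^sup>*"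
    by (rule rtrancl_subset_rtrancl)
  with F show ?thesis by blast
qed

text \<open>The bounds \<open>3 * h / 4\<close> and \<open>5 * h / 4\<close> are close enough to
  \<open>h\<close> for the left side to exceed the first term on the right by
  \<open>r * h / 2\<close>, so \<open>\<delta>\<close> must grow with \<open>r\<close>. The pattern
  does not depend on \<open>\<delta>\<close>, which can therefore be quantified inside the almost
  sure statement.\<close>

lemma AE_four_point_inequality:
  fixes \<rho> :: "real measure" and h :: real
  assumes \<rho>: "edge_length_distribution \<rho>" and h: "h > 0" "0 \<in> measure_support \<rho>" "h \<in> measure_support \<rho>"
    and inf: "infinite V"
    and cofinite: "\<And>K. finite K \<Longrightarrow> K \<subseteq> V \<Longrightarrow>
      \<exists>F. finite F \<and> (\<forall>x\<in>V - F. \<forall>y\<in>V - F. (x, y) \<in> (Restr (adj E) (V - K))\<^sup>*)"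
  shows "AE \<omega> in PiM E (\<lambda>_. \<rho>). \<forall>\<delta>.
    (\<forall>w\<in>V. \<forall>x\<in>V. \<forall>y\<in>V. \<forall>z\<in>V. gromov_product (fpp_dist E \<omega>) w x z \<ge>
       min (gromov_product (fpp_dist E \<omega>) w x y) (gromov_product (fpp_dist E \<omega>) w y z) - \<delta>) \<longrightarrow>
    4 * real r * (3 * h / 4) \<le> 2 * real r * (5 * h / 4) + 1 + 2 * \<delta>"
proof -
  interpret \<rho>: prob_space \<rho>
    using \<rho> by (simp add: edge_length_distribution_def)
  have sets_\<rho>: "sets \<rho> = sets (restrict_space borel {0..})"
    using \<rho> by (simp add: edge_length_distribution_def)
  have space_\<rho>: "space \<rho> = {0..}"
    by (simp add: sets_eq_imp_space_eq[OF sets_\<rho>] space_restrict_space)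
  define K where "K = {x \<in> V. gdist E \<one> x < 2 * r}"
  let ?R = "Restr (adj E) (V - K)"
  obtain F where F: "finite F" "\<And>x y. x \<in> V - F \<Longrightarrow> y \<in> V - F \<Longrightarrow> (x, y) \<in> ?R\<^sup>*"
    using cofinite[of K] finite_ball by (auto simp: K_def)
  obtain m where m: "\<And>x. x \<in> F \<Longrightarrow> gdist E \<one> x < m"
    using F(1) finite_nat_set_iff_bounded[of "gdist E \<one> ` F"] by auto
  \<comment> \<open>The ends of the geodesic, at distance \<open>M\<close> from
    \<open>\<one>\<close>, then lie outside \<open>F\<close>; \<open>2 * r \<le> M\<close> makes
    room for its points at distance \<open>2 * r\<close> from the centre.\<close>
  define M where "M = max m (2 * r)"
  obtain a where a: "geodesic E (2 * M) a" "a ` {..2 * M} \<subseteq> V" "a M = \<one>"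
    using centred_geodesic_exists[OF inf] by metis
  have aV: "a i \<in> V" if "i \<le> 2 * M" for i
    using a(2) that by auto
  have dist_a: "gdist E \<one> (a i) = (if i \<le> M then M - i else i - M)" if "i \<le> 2 * M" for i
    using a(1) that gdist_sym[of E "a M" "a i"] unfolding a(3)[symmetric] by (auto simp: geodesic_def)
  \<comment> \<open>The outer stretches of the geodesic avoid \<open>K\<close>. The chain
    \<open>b\<close> arises by going out to one end, crossing to the other end off \<open>K\<close>
    and coming back.\<close>
  have step: "(a i, a (Suc i)) \<in> ?R" if "i < M - 2 * r \<or> M + 2 * r \<le> i" "i < 2 * M" for i
  proof -
    have "{a i, a (Suc i)} \<in> E"
      using a(1) that by (simp add: geodesic_def)
    moreover have "a i \<notin> K" "a (Suc i) \<notin> K"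
      using that dist_a[of i] dist_a[of "Suc i"] by (auto simp: K_def split: if_splits)
    ultimately show ?thesis
      using that aV[of i] aV[of "Suc i"] by auto
  qed
  have left: "(a 0, a k) \<in> ?R\<^sup>*" if "k \<le> M - 2 * r" for k
    using that
  proof (induction k)
    case (Suc k)
    then have "(a 0, a k) \<in> ?R\<^sup>*" "(a k, a (Suc k)) \<in> ?R"
      using step[of k] by simp_all
    then show ?case ..
  qed simp
  have right: "(a (M + 2 * r), a (M + 2 * r + k)) \<in> ?R\<^sup>*" if "M + 2 * r + k \<le> 2 * M" for k
    using that
  proof (induction k)
    case (Suc k)
    then have "(a (M + 2 * r), a (M + 2 * r + k)) \<in> ?R\<^sup>*" "(a (M + 2 * r + k), a (Suc (M + 2 * r + k))) \<in> ?R"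
      using step[of "M + 2 * r + k"] by simp_all
    then show ?case
      unfolding add_Suc_right ..
  qed simp
  have "M + 2 * r + (M - 2 * r) = 2 * M"
    by (simp add: M_def)
  then have ends: "(a 0, a (M - 2 * r)) \<in> ?R\<^sup>*" "(a (M + 2 * r), a (2 * M)) \<in> ?R\<^sup>*"
    using left[of "M - 2 * r"] right[of "M - 2 * r"] by simp_all
  have "m \<le> M"
    by (simp add: M_def)
  moreover have "gdist E \<one> (a 0) = M" "gdist E \<one> (a (2 * M)) = M"
    using dist_a[of 0] dist_a[of "2 * M"] by auto
  ultimately have "a 0 \<notin> F" "a (2 * M) \<notin> F"
    using m[of "a 0"] m[of "a (2 * M)"] by auto
  then have "(a 0, a (2 * M)) \<in> ?R\<^sup>*"
    using F(2) aV by simp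
  with ends have "(a (M - 2 * r), a (M + 2 * r)) \<in> ?R\<^sup>*"
    using sym_rtrancl[OF sym_adj_Restr[of E "V - K"]] by (meson symD rtrancl_trans)
  then obtain b n where b: "b 0 = a (M - 2 * r)" "b n = a (M + 2 * r)"
    "\<And>i. i < n \<Longrightarrow> {b i, b (Suc i)} \<in> E" "\<And>i. i < n \<Longrightarrow> b i \<in> V - K" "\<And>i. i < n \<Longrightarrow> b (Suc i) \<in> V - K"
    by (rule rtrancl_chain) blast
  define J1 where "J1 = {e \<in> E. e \<inter> K \<noteq> {}}"
  define J2 where "J2 = (\<lambda>i. {b i, b (Suc i)}) ` {..<n}"
  \<comment> \<open>These are open neighbourhoods of the support points \<open>h\<close> and 0. The
    bound \<open>1 / real (Suc n)\<close> makes the \<open>n\<close> edges of the chain cost at most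
    1 together; \<open>Suc\<close> keeps it meaningful for \<open>n = 0\<close>.\<close>
  define Y where "Y e = (if e \<in> J1 then {3 * h / 4<..<5 * h / 4} else {..<1 / real (Suc n)})" for e
  have "J1 \<subseteq> (\<lambda>(x, s). {x, x \<otimes> s}) ` (K \<times> S)"
  proof
    fix e assume e: "e \<in> J1"
    then obtain x where x: "x \<in> e" "x \<in> K"
      by (auto simp: J1_def)
    with e obtain y where "e = {x, y}"
      by (auto simp: J1_def cayley_edges_def)
    with e x edge_iff[of x y] show "e \<in> (\<lambda>(x, s). {x, x \<otimes> s}) ` (K \<times> S)"
      by (auto simp: J1_def)
  qed
  then have "finite J1"
    by (rule finite_subset) (use finite_ball S_props(1) in \<open>auto simp: K_def\<close>)
  then have finJ: "finite (J1 \<union> J2)"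
    by (simp add: J2_def)
  have JE: "J1 \<union> J2 \<subseteq> E"
    using b(3) by (auto simp: J1_def J2_def)
  \<comment> \<open>The chain avoids \<open>K\<close>, so no edge is asked to be both near
    \<open>h\<close> and cheap.\<close>
  have disj: "e \<notin> J1" if "e \<in> J2" for e
    using that b(4,5) by (auto simp: J1_def J2_def)
  have meas: "measure \<rho> (Y e \<inter> {0..}) > 0" for e
  proof -
    have "open (Y e)" "0 \<in> Y e \<or> h \<in> Y e"
      using h(1) by (auto simp: Y_def)
    then have "emeasure \<rho> (Y e \<inter> space \<rho>) > 0"
      using h(2,3) by (auto simp: measure_support_def)
    then show ?thesis
      by (simp add: \<rho>.emeasure_eq_measure space_\<rho>)
  qed
  have Y_sets: "Y e \<inter> {0..} \<in> sets \<rho>" for e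
    by (auto simp: sets_\<rho> sets_restrict_space Y_def)
  have "AE \<omega> in PiM E (\<lambda>_. \<rho>). \<exists>g\<in>V. \<forall>e\<in>J1 \<union> J2. \<omega> ((\<otimes>) g ` e) \<in> Y e \<inter> {0..}"
  proof (rule AE_PiM_pattern[where \<phi> = "\<lambda>g e. (\<otimes>) g ` e", OF \<rho>.prob_space_axioms finJ Y_sets meas])
    fix g e assume g: "g \<in> V" and "e \<in> J1 \<union> J2"
    with JE have "e \<in> E"
      by blast
    moreover then obtain x y where "e = {x, y}"
      by (auto simp: cayley_edges_def)
    ultimately show "(\<otimes>) g ` e \<in> E"
      using edge_translate[OF g] by simp
  qed (rule disjoint_translates[OF inf finJ JE])
  then show ?thesis
    using AE_space
  proof eventually_elim
    case (elim \<omega>)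
    then obtain g where g: "g \<in> V" "\<And>e. e \<in> J1 \<union> J2 \<Longrightarrow> \<omega> ((\<otimes>) g ` e) \<in> Y e"
      by auto
    have nonneg: "0 \<le> \<omega> e" if "e \<in> E" for e
      using elim(2) that by (auto simp: space_PiM space_\<rho>)
    show ?case
    proof (intro allI impI)
      fix \<delta>
      assume hyp: "\<forall>w\<in>V. \<forall>x\<in>V. \<forall>y\<in>V. \<forall>z\<in>V. gromov_product (fpp_dist E \<omega>) w x z \<ge>
        min (gromov_product (fpp_dist E \<omega>) w x y) (gromov_product (fpp_dist E \<omega>) w y z) - \<delta>"
      have near: "3 * h / 4 \<le> \<omega> {u, v} \<and> \<omega> {u, v} \<le> 5 * h / 4"
        if "{u, v} \<in> E" "gdist E (g \<otimes> a M) u < 2 * r" for u v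
      proof -
        have uv: "u \<in> V" "v \<in> V"
          using edge_subset[OF that(1)] by auto
        \<comment> \<open>The translated pattern is centred at \<open>g \<otimes> a M = g\<close>;
          \<open>inv g\<close> brings the edge back to \<open>J1\<close>.\<close>
        have "gdist E \<one> (inv g \<otimes> u) < 2 * r"
          using gdist_translate[of "inv g" g u] that(2) g(1) uv a(3) by simp
        moreover have "{inv g \<otimes> u, inv g \<otimes> v} \<in> E"
          using edge_translate[OF _ that(1), of "inv g"] g(1) by simp
        ultimately have J: "{inv g \<otimes> u, inv g \<otimes> v} \<in> J1"
          using g(1) uv by (simp add: J1_def K_def)
        then have "\<omega> ((\<otimes>) g ` {inv g \<otimes> u, inv g \<otimes> v}) \<in> Y {inv g \<otimes> u, inv g \<otimes> v}"
          by (intro g) simp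
        with J g(1) uv show ?thesis
          by (simp add: Y_def m_assoc[symmetric])
      qed
      have cheap: "\<omega> {g \<otimes> b i, g \<otimes> b (Suc i)} \<le> 1 / real (Suc n)" if "i < n" for i
      proof -
        have "{b i, b (Suc i)} \<in> J2"
          using that by (auto simp: J2_def)
        with g(2)[of "{b i, b (Suc i)}"] disj[of "{b i, b (Suc i)}"] show ?thesis
          by (simp add: Y_def)
      qed
      have "4 * real r * (3 * h / 4) \<le> 2 * real r * (5 * h / 4) + real n * (1 / real (Suc n)) + 2 * \<delta>"
      proof (rule four_point_inequality[where E = E and V = V and a = "\<lambda>i. g \<otimes> a i" and M = M
            and b = "\<lambda>i. g \<otimes> b i" and \<omega> = \<omega>])
        show "geodesic E (2 * M) (\<lambda>i. g \<otimes> a i)"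
          using a(1) aV g(1) by (simp add: geodesic_def edge_translate gdist_translate)
        show "(\<lambda>i. g \<otimes> a i) ` {..2 * M} \<subseteq> V"
          using aV g(1) by auto
      qed (use near cheap nonneg edge_subset connected hyp b(1-3) g(1) h(1) in
          \<open>auto simp: M_def intro: edge_translate\<close>)
      moreover have "real n * (1 / real (Suc n)) \<le> 1"
        by (simp add: field_simps)
      ultimately show "4 * real r * (3 * h / 4) \<le> 2 * real r * (5 * h / 4) + 1 + 2 * \<delta>"
        by linarith
    qed
  qed
qed

end

section \<open>From every scale to the failure of hyperbolicity\<close>

theorem corollary5p16:
  fixes G :: "('a, 'b) monoid_scheme" and S :: "'a set" and \<rho> :: "real measure" and h :: real
  assumes "hyperbolic_group G"
    and "fin_sym_gen_set G S"
    and "edge_length_distribution \<rho>"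
    and "one_ended_group G"
    and "h > 0" and "{0..h} \<subseteq> measure_support \<rho>"
  shows "AE \<omega> in fpp_measure (cayley_edges G S) \<rho>.
           \<not> gromov_hyperbolic (carrier G) (fpp_dist (cayley_edges G S) \<omega>)"
proof -
  obtain S' where S': "group G" "fin_sym_gen_set G S'" "one_ended (carrier G) (cayley_edges G S')"
    using assms(4) by (auto simp: one_ended_group_def)
  interpret cayley_graph G S
    using S'(1) assms(2) by (simp add: cayley_graph_def cayley_graph_axioms_def)
  have G': "cayley_graph G S'"
    using S' by (simp add: cayley_graph_def cayley_graph_axioms_def)
  \<comment> \<open>The scale \<open>r\<close> is a natural number, so the exceptional null sets can
    be united; the uncountably many \<open>\<delta>\<close> are already handled within each
    scale.\<close>
  have "AE \<omega> in PiM E (\<lambda>_. \<rho>). \<forall>r \<delta>.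
    (\<forall>w\<in>V. \<forall>x\<in>V. \<forall>y\<in>V. \<forall>z\<in>V. gromov_product (fpp_dist E \<omega>) w x z \<ge>
       min (gromov_product (fpp_dist E \<omega>) w x y) (gromov_product (fpp_dist E \<omega>) w y z) - \<delta>) \<longrightarrow>
    4 * real r * (3 * h / 4) \<le> 2 * real r * (5 * h / 4) + 1 + 2 * \<delta>"
    unfolding AE_all_countable
    using assms(3,5,6) cayley_graph.one_ended_infinite[OF G' S'(3)] one_ended_cofinite_gens[OF G' S'(3)]
    by (intro allI AE_four_point_inequality) auto
  then have "AE \<omega> in PiM E (\<lambda>_. \<rho>). \<not> gromov_hyperbolic V (fpp_dist E \<omega>)"
  proof eventually_elim
    case (elim \<omega>)
    show ?case
    proof
      assume "gromov_hyperbolic V (fpp_dist E \<omega>)"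
      then obtain \<delta> where \<delta>: "4 * real r * (3 * h / 4) \<le> 2 * real r * (5 * h / 4) + 1 + 2 * \<delta>" for r
        using elim unfolding gromov_hyperbolic_def by blast
      \<comment> \<open>The coefficients 3 and 5/2 of \<open>r * h\<close> differ by 1/2, which
        leaves a quantity unbounded in \<open>r\<close> on the left.\<close>
      have "real r * h \<le> 2 + 4 * \<delta>" for r
        using \<delta>[of r] by (simp add: field_simps)
      moreover obtain r where "2 + 4 * \<delta> < real r * h"
        using reals_Archimedean3[OF assms(5)] by blast
      ultimately show False
        by (meson not_le)
    qed
  qed
  then show ?thesis
    unfolding fpp_measure_def by (rule AE_completion)
qed

end
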